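(* Let $G = K_{n_1}\,\square\,\cdots\,\square\, K_{n_r}$ be a Hamming graph ($r\ge 1$, $n_i\ge 2$) and $X\subseteq V(G)$. The following are equivalent: (i) $X$ is a total mutual-visibility set of $G$; (ii) there are no $u,v\in X$ with $d_G(u,v)=2$; (iii) every Cartesian square of $G$ is $X$-suitable.
   Context: $\square$ is the Cartesian product of graphs; a Hamming graph is a Cartesian product of complete graphs, with vertices $r$-tuples $(u_1,\dots,u_r)$, $u_i\in[n_i]$, adjacent iff they differ in exactly one coordinate. $d_G$ is the shortest-path distance. For $X\subseteq V(G)$, vertices $x,y$ are $X$-visible if some shortest $x,y$-path has no internal vertex in $X$; $X$ is a total mutual-visibility set if every two vertices of $G$ are $X$-visible. A Cartesian square of $G$ is a 4-cycle on vertices $u,u',u'',u'''$ for which there are indices $i<j$ and values $u_i\ne u_i'$, $u_j\ne u_j'$ such that $u$ has coordinates $(u_i,u_j)$ in positions $i,j$, $u'$ has $(u_i,u_j')$, $u''$ has $(u_i',u_j')$, $u'''$ has $(u_i',u_j)$, and all four agree in all other coordinates. A Cartesian square is $X$-suitable if $X$ contains no diametral (i.e., distance-2, non-adjacent) pair of its vertices. *)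

theory Defs
  imports "Graph_Theory.Graph_Theory"
begin

text \<open>As in the library, an undirected graph is a symmetric digraph: each edge is represented by
  its two arcs.\<close>

definition complete_graph :: "nat \<Rightarrow> nat pair_pre_digraph" where
  "complete_graph n = \<lparr> pverts = {1..n},
     parcs = {(a, b). a \<in> {1..n} \<and> b \<in> {1..n} \<and> a \<noteq> b} \<rparr>"

text \<open>\<open>G\<^sub>1 \<box> \<dots> \<box> G\<^sub>r\<close>, with \<open>r\<close>-tuples rendered as lists of length \<open>r\<close>.
  Coordinates are therefore numbered from \<open>0\<close> to \<open>r - 1\<close>.\<close>

definition cartesian_product :: "'a pair_pre_digraph list \<Rightarrow> 'a list pair_pre_digraph" where
  "cartesian_product Gs = \<lparr> pverts = listset (map pverts Gs),
     parcs = {(u, v). u \<in> listset (map pverts Gs) \<and> v \<in> listset (map pverts Gs) \<and>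
       (\<exists>i < length Gs. (u ! i, v ! i) \<in> parcs (Gs ! i) \<and>
          (\<forall>j < length Gs. j \<noteq> i \<longrightarrow> u ! j = v ! j))} \<rparr>"

definition hamming_graph :: "nat list \<Rightarrow> nat list pair_pre_digraph" where
  "hamming_graph ns = cartesian_product (map complete_graph ns)"

text \<open>\<open>\<mu>\<close> with unit weights is the infimum of the lengths of all walks; the value is
  \<open>\<infinity>\<close> if there is none.\<close>

definition graph_dist :: "'a pair_pre_digraph \<Rightarrow> 'a \<Rightarrow> 'a \<Rightarrow> ereal" where
  "graph_dist G x y = wf_digraph.\<mu> (with_proj G) (\<lambda>_. 1) x y"

definition shortest_path :: "'a pair_pre_digraph \<Rightarrow> 'a \<Rightarrow> ('a \<times> 'a) awalk \<Rightarrow> 'a \<Rightarrow> bool" where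
  "shortest_path G x p y \<longleftrightarrow>
     pre_digraph.apath (with_proj G) x p y \<and> ereal (real (length p)) = graph_dist G x y"

definition visible :: "'a pair_pre_digraph \<Rightarrow> 'a set \<Rightarrow> 'a \<Rightarrow> 'a \<Rightarrow> bool" where
  "visible G X x y \<longleftrightarrow>
     (\<exists>p. shortest_path G x p y \<and> set (pre_digraph.inner_verts (with_proj G) p) \<inter> X = {})"

definition total_mutual_visibility_set :: "'a pair_pre_digraph \<Rightarrow> 'a set \<Rightarrow> bool" where
  "total_mutual_visibility_set G X \<longleftrightarrow>
     X \<subseteq> pverts G \<and> (\<forall>x \<in> pverts G. \<forall>y \<in> pverts G. visible G X x y)"

text \<open>\<open>a\<close> and \<open>b\<close> are the values \<open>u\<^sub>i'\<close> and \<open>u\<^sub>j'\<close>; they lie in the right ranges because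
  the vertices of a cycle are vertices of the graph.\<close>

definition cartesian_square ::
  "nat list \<Rightarrow> nat list \<Rightarrow> nat list \<Rightarrow> nat list \<Rightarrow> nat list \<Rightarrow> bool" where
  "cartesian_square ns u u' u'' u''' \<longleftrightarrow>
     pre_digraph.cycle (with_proj (hamming_graph ns)) [(u, u'), (u', u''), (u'', u'''), (u''', u)] \<and>
     (\<exists>i j a b. i < j \<and> j < length ns \<and> a \<noteq> u ! i \<and> b \<noteq> u ! j \<and>
        u' = u[j := b] \<and> u'' = u[i := a, j := b] \<and> u''' = u[i := a])"

definition suitable :: "'a pair_pre_digraph \<Rightarrow> 'a set \<Rightarrow> 'a set \<Rightarrow> bool" where
  "suitable G X S \<longleftrightarrow>
     \<not> (\<exists>x \<in> S. \<exists>y \<in> S. graph_dist G x y = 2 \<and> (x, y) \<notin> parcs G \<and> x \<in> X \<and> y \<in> X)"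

lemma in_listset_iff:
  "u \<in> listset As \<longleftrightarrow> length u = length As \<and> (\<forall>i < length As. u ! i \<in> As ! i)"
proof (induction As arbitrary: u)
  case (Cons A As)
  show ?case
    by (cases u) (simp_all add: set_Cons_def Cons.IH All_less_Suc2 conj_ac)
qed simp

lemma complete_digraph_complete_graph: "complete_digraph n (with_proj (complete_graph n))"
  by (auto simp: complete_digraph_pair_def complete_graph_def)

lemma pverts_hamming_graph:
  "pverts (hamming_graph ns) =
     {u. length u = length ns \<and> (\<forall>i < length ns. u ! i \<in> {1..ns ! i})}"
  by (auto simp: hamming_graph_def cartesian_product_def in_listset_iff complete_graph_def)

lemma parcs_hamming_graph:
  "(u, v) \<in> parcs (hamming_graph ns) \<longleftrightarrow>
     u \<in> pverts (hamming_graph ns) \<and> v \<in> pverts (hamming_graph ns) \<and>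
     (\<exists>!i. i < length ns \<and> u ! i \<noteq> v ! i)"
proof -
  let ?V = "pverts (hamming_graph ns)"
  have *: "(u, v) \<in> parcs (hamming_graph ns) \<longleftrightarrow> u \<in> ?V \<and> v \<in> ?V \<and>
     (\<exists>i < length ns. (u ! i, v ! i) \<in> parcs (complete_graph (ns ! i)) \<and>
        (\<forall>j < length ns. j \<noteq> i \<longrightarrow> u ! j = v ! j))"
    by (simp add: hamming_graph_def cartesian_product_def cong: conj_cong)
  have "(u ! i, v ! i) \<in> parcs (complete_graph (ns ! i)) \<longleftrightarrow> u ! i \<noteq> v ! i"
    if "u \<in> ?V" "v \<in> ?V" "i < length ns" for i
    using that by (simp add: pverts_hamming_graph complete_graph_def)
  with * show ?thesis
    by blast
qed

lemma pair_graph_hamming_graph: "pair_graph (hamming_graph ns)"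
proof -
  let ?V = "pverts (hamming_graph ns)" and ?A = "parcs (hamming_graph ns)"
  let ?L = "{u. set u \<subseteq> {..Max (set ns)} \<and> length u = length ns}"
  have "?V \<subseteq> ?L"
  proof
    fix u assume u: "u \<in> ?V"
    have "u ! i \<le> Max (set ns)" if "i < length ns" for i
    proof -
      have "u ! i \<le> ns ! i"
        using u that by (simp add: pverts_hamming_graph)
      also have "\<dots> \<le> Max (set ns)"
        using that by (intro Max_ge) simp_all
      finally show ?thesis .
    qed
    then show "u \<in> ?L"
      using u by (simp add: pverts_hamming_graph subset_iff in_set_conv_nth) metis
  qed
  then have V: "finite ?V"
    by (rule finite_subset) (simp add: finite_lists_length_eq)
  have arcs: "?A \<subseteq> ?V \<times> ?V"
    by (rule subrelI) (simp add: parcs_hamming_graph)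
  then have A: "finite ?A"
    by (rule finite_subset) (simp add: V)
  have sym: "sym ?A"
    by (rule symI) (simp add: parcs_hamming_graph neq_commute)
  have loopfree: "fst e \<noteq> snd e" if "e \<in> ?A" for e
    using that by (cases e) (simp add: parcs_hamming_graph, metis)
  have ends: "fst e \<in> ?V" "snd e \<in> ?V" if "e \<in> ?A" for e
    using that arcs by (auto simp only: subset_iff mem_Times_iff)
  show ?thesis
    by unfold_locales (simp_all add: V A sym loopfree ends symmetric_def)
qed

end

theory Submission
  imports Defs
begin

text \<open>The distance of two vertices of a Hamming graph is the number of coordinates in which they
  differ, and the first step of a shortest path from \<open>u\<close> to \<open>v\<close> replaces a differing coordinate of
  \<open>u\<close> by that of \<open>v\<close>. Two different first steps lead to vertices at distance 2, so if \<open>X\<close> contains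
  no such pair, then at most one of them leads into \<open>X\<close>, and a shortest path avoiding \<open>X\<close> can be
  built greedily. Conversely, if \<open>u, v \<in> X\<close> are at distance 2, then they are one diagonal of
  a Cartesian square, and they are the only common neighbours of the vertices of the other diagonal,
  which therefore do not see each other.\<close>

section \<open>Sets of differing coordinates\<close>

text \<open>The indices range over the length of the first list, so facts that exchange the two
  lists or deduce their equality assume equal lengths.\<close>

definition differ :: "'a list \<Rightarrow> 'a list \<Rightarrow> nat set" where
  "differ u v = {i. i < length u \<and> u ! i \<noteq> v ! i}"

lemma finite_differ [simp]: "finite (differ u v)"
  by (simp add: differ_def)

lemma nth_eq_if_not_differ: "m < length u \<Longrightarrow> m \<notin> differ u v \<Longrightarrow> u ! m = v ! m"
  by (simp add: differ_def)

lemma differ_commute: "length u = length v \<Longrightarrow> differ u v = differ v u"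
  by (auto simp: differ_def)

lemma differ_empty_iff: "length u = length v \<Longrightarrow> differ u v = {} \<longleftrightarrow> u = v"
  by (auto simp: differ_def list_eq_iff_nth_eq)

lemma differ_subset_Un: "length u = length w \<Longrightarrow> differ u v \<subseteq> differ u w \<union> differ w v"
  by (auto simp: differ_def)

lemma differ_update_left: "differ (u[i := v ! i]) v = differ u v - {i}"
proof -
  have "m \<in> differ (u[i := v ! i]) v \<longleftrightarrow> m \<in> differ u v - {i}" for m
    by (cases "m = i") (auto simp: differ_def)
  then show ?thesis by blast
qed

lemma differ_update_right: "i \<in> differ u v \<Longrightarrow> differ u (u[i := v ! i]) = {i}"
  by (auto simp: differ_def nth_list_update split: if_splits)

lemma differ_update_update:
  assumes "i \<in> differ u v" "j \<in> differ u v" "i \<noteq> j"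
  shows "differ (u[i := v ! i]) (u[j := v ! j]) = {i, j}"
  using assms by (auto simp: differ_def nth_list_update split: if_splits)

text \<open>Brings \<open>v\<close> into the form that \<open>cartesian_square\<close> demands of
  the corner opposite to \<open>u\<close>.\<close>

lemma eq_update2_if_differ_eq:
  assumes "length u = length v" "differ u v = {i, j}"
  shows "v = u[i := v ! i, j := v ! j]"
proof (rule nth_equalityI)
  have "i \<in> differ u v" "j \<in> differ u v"
    using assms(2) by simp_all
  then have ij: "i < length u" "j < length u"
    by (simp_all add: differ_def)
  fix m assume m: "m < length v"
  have "u ! m = v ! m" if "m \<noteq> i" "m \<noteq> j"
    using nth_eq_if_not_differ[of m u v] m that assms by simp
  then show "v ! m = u[i := v ! i, j := v ! j] ! m"
    using ij by (cases "m = j"; cases "m = i") simp_all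
qed (simp add: assms(1))

text \<open>The two ends differ exactly in \<open>i\<close> and \<open>j\<close>, so the steps into
  and out of \<open>z\<close> change these two coordinates, one each. Changing \<open>i\<close>
  first undoes the update and gives \<open>u\<close>; changing \<open>j\<close> first completes it
  and gives \<open>v\<close>.\<close>

lemma middle_of_path2:
  assumes len: "length u = length v" "length z = length u"
    and uv: "differ u v = {i, j}" "i \<noteq> j"
    and k: "differ (u[i := v ! i]) z = {k}" and l: "differ z (u[j := v ! j]) = {l}"
  shows "z = u \<or> z = v"
proof -
  have "i \<in> differ u v" "j \<in> differ u v"
    using uv by simp_all
  then have ij: "i < length u" "j < length u"
    by (simp_all add: differ_def)
  \<comment> \<open>The coordinates in which the ends differ are among those changed by the two
    steps; as \<open>i\<close> and \<open>j\<close> are distinct, they exhaust \<open>k\<close> and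
    \<open>l\<close>.\<close>
  have sub: "{i, j} \<subseteq> {k, l}"
    using differ_subset_Un[of "u[i := v ! i]" z "u[j := v ! j]"] differ_update_update[of i u v j]
      uv k l len by auto
  have K: "u[i := v ! i] ! m = z ! m" if "m < length u" "m \<noteq> k" for m
    using that k by (intro nth_eq_if_not_differ) simp_all
  have L: "z ! m = u[j := v ! j] ! m" if "m < length u" "m \<noteq> l" for m
    using that l len by (intro nth_eq_if_not_differ) simp_all
  have M: "u ! m = v ! m" if "m < length u" "m \<noteq> i" "m \<noteq> j" for m
    using that uv by (intro nth_eq_if_not_differ) simp_all
  from sub consider "k = i" "l = j" | "k = j" "l = i"
    using uv(2) by blast
  then show ?thesis
  proof cases
    case 1
    have "z ! m = u ! m" if "m < length u" for m
      using K[of m] L[of m] that 1 uv(2) by (cases "m = i") auto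
    then show ?thesis
      using len by (simp add: list_eq_iff_nth_eq)
  next
    case 2
    have "z ! m = v ! m" if "m < length u" for m
      using K[of m] L[of m] M[of m] that 2 uv(2) ij by (cases "m = i"; cases "m = j") auto
    then show ?thesis
      using len by (simp add: list_eq_iff_nth_eq)
  qed
qed

section \<open>Vertices and arcs of Hamming graphs\<close>

lemma length_hamming_vertex: "u \<in> pverts (hamming_graph ns) \<Longrightarrow> length u = length ns"
  by (simp add: pverts_hamming_graph)

lemma update_in_hamming_graph:
  assumes "u \<in> pverts (hamming_graph ns)" "v \<in> pverts (hamming_graph ns)"
  shows "u[i := v ! i] \<in> pverts (hamming_graph ns)"
proof -
  have "u[i := v ! i] ! m \<in> {1..ns ! m}" if "m < length ns" for m
    using assms that by (cases "m = i") (auto simp: pverts_hamming_graph)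
  then show ?thesis
    using assms by (simp add: pverts_hamming_graph)
qed

lemma hamming_arc_iff:
  "(u, v) \<in> parcs (hamming_graph ns) \<longleftrightarrow>
     u \<in> pverts (hamming_graph ns) \<and> v \<in> pverts (hamming_graph ns) \<and> (\<exists>i. differ u v = {i})"
proof -
  have "(\<exists>!i. i < length ns \<and> u ! i \<noteq> v ! i) \<longleftrightarrow> (\<exists>i. differ u v = {i})"
    if "u \<in> pverts (hamming_graph ns)"
    using that by (simp add: differ_def length_hamming_vertex Ex1_def set_eq_iff) metis
  then show ?thesis
    unfolding parcs_hamming_graph by metis
qed

lemma wf_digraph_hamming_graph: "wf_digraph (with_proj (hamming_graph ns))"
proof -
  interpret pair_graph "hamming_graph ns" by (rule pair_graph_hamming_graph)
  show ?thesis by unfold_locales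
qed

section \<open>Distances and shortest paths that avoid a set\<close>

text \<open>Each arc changes one coordinate, so a step removes at most one element from the set of
  coordinates still to be corrected. Arbitrary walks are treated because the infimum in
  \<open>\<mu>\<close> ranges over them.\<close>

lemma card_differ_le_length_awalk:
  assumes "pre_digraph.awalk (with_proj (hamming_graph ns)) u p v"
  shows "card (differ u v) \<le> length p"
proof -
  interpret wf_digraph "with_proj (hamming_graph ns)" by (rule wf_digraph_hamming_graph)
  from assms show ?thesis
  proof (induction p arbitrary: u)
    case Nil
    then show ?case by (simp add: awalk_Nil_iff differ_def)
  next
    case (Cons e p)
    obtain w where e: "e = (u, w)" and arc: "(u, w) \<in> parcs (hamming_graph ns)"
      and w: "awalk w p v"
      using Cons.prems by (cases e) (auto simp: awalk_Cons_iff)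
    obtain i where "differ u w = {i}" "length u = length w"
      using arc by (auto simp: hamming_arc_iff length_hamming_vertex)
    then have "differ u v \<subseteq> insert i (differ w v)"
      using differ_subset_Un[of u w v] by simp
    then have "card (differ u v) \<le> card (insert i (differ w v))"
      by (intro card_mono) simp_all
    also have "\<dots> \<le> Suc (card (differ w v))"
      by (rule card_insert_le_m1) simp_all
    finally show ?case
      using Cons.IH[OF w] by simp
  qed
qed

text \<open>If a single coordinate is left, correcting it reaches \<open>v\<close>, which as an end
  vertex may lie in \<open>X\<close>. Otherwise, correcting \<open>i\<close> and correcting
  \<open>j\<close> lead to vertices that differ in exactly \<open>i\<close> and \<open>j\<close>, so
  they are not both in \<open>X\<close>.\<close>

lemma ex_step_avoiding:
  assumes V: "u \<in> pverts (hamming_graph ns)" "v \<in> pverts (hamming_graph ns)" and "u \<noteq> v"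
    and X: "\<And>x y. x \<in> X \<Longrightarrow> y \<in> X \<Longrightarrow> card (differ x y) \<noteq> 2"
  shows "\<exists>i \<in> differ u v. u[i := v ! i] = v \<or> u[i := v ! i] \<notin> X"
proof -
  have len: "length u = length v"
    using V by (simp add: length_hamming_vertex)
  with \<open>u \<noteq> v\<close> obtain i where i: "i \<in> differ u v"
    using differ_empty_iff by blast
  show ?thesis
  proof (cases "differ u v = {i}")
    case True
    then have "u[i := v ! i] = v"
      using differ_empty_iff[of "u[i := v ! i]" v] by (simp add: differ_update_left len)
    with i show ?thesis by blast
  next
    case False
    with i obtain j where j: "j \<in> differ u v" "i \<noteq> j" by blast
    have "card (differ (u[i := v ! i]) (u[j := v ! j])) = 2"
      using i j by (simp add: differ_update_update)
    with X i j(1) show ?thesis by blast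
  qed
qed

text \<open>The bound on \<open>differ w v\<close> for the vertices \<open>w\<close> of the walk is what makes it a path: the step
  out of \<open>u\<close> removes an element of \<open>differ u v\<close>, so \<open>u\<close> is not met again.\<close>

lemma ex_path_avoiding:
  assumes "u \<in> pverts (hamming_graph ns)" "v \<in> pverts (hamming_graph ns)"
    and X: "\<And>x y. x \<in> X \<Longrightarrow> y \<in> X \<Longrightarrow> card (differ x y) \<noteq> 2"
  shows "\<exists>p. pre_digraph.apath (with_proj (hamming_graph ns)) u p v \<and>
     length p = card (differ u v) \<and>
     (\<forall>w \<in> set (pre_digraph.awalk_verts (with_proj (hamming_graph ns)) u p).
        differ w v \<subseteq> differ u v) \<and>
     set (pre_digraph.inner_verts (with_proj (hamming_graph ns)) p) \<inter> X = {}"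
proof -
  interpret pair_graph "hamming_graph ns" by (rule pair_graph_hamming_graph)
  let ?G = "with_proj (hamming_graph ns)"
  show ?thesis
    using assms(1)
  proof (induction "card (differ u v)" arbitrary: u)
    case 0
    then have "u = v"
      using differ_empty_iff[of u v] assms(2) by (simp add: length_hamming_vertex)
    with assms(2) 0 show ?case
      by (intro exI[of _ "[]"]) (simp add: apath_Nil_iff)
  next
    case (Suc n)
    have "u \<noteq> v"
      using Suc.hyps(2) by (auto simp: differ_def)
    then obtain i where i: "i \<in> differ u v" and iX: "u[i := v ! i] = v \<or> u[i := v ! i] \<notin> X"
      using ex_step_avoiding[OF Suc.prems assms(2) _ X] by blast
    define w where "w = u[i := v ! i]"
    have w: "w \<in> pverts (hamming_graph ns)"
      using Suc.prems assms(2) by (simp add: w_def update_in_hamming_graph)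
    have wv: "differ w v = differ u v - {i}"
      by (simp add: w_def differ_update_left)
    have arc: "(u, w) \<in> parcs (hamming_graph ns)"
      using w Suc.prems i differ_update_right[OF i] by (auto simp: hamming_arc_iff w_def)
    have n: "n = card (differ w v)"
      using Suc.hyps(2) i by (simp add: wv)
    from Suc.hyps(1)[OF n w] obtain p where p: "pre_digraph.apath ?G w p v"
      "length p = card (differ w v)"
      "\<forall>z \<in> set (pre_digraph.awalk_verts ?G w p). differ z v \<subseteq> differ w v"
      "set (pre_digraph.inner_verts ?G p) \<inter> X = {}"
      by blast
    have "u \<notin> set (pre_digraph.awalk_verts ?G w p)"
      using p(3) i wv by blast
    then have path: "pre_digraph.apath ?G u ((u, w) # p) v"
      using p(1) arc by (simp add: apath_Cons_iff)
    \<comment> \<open>The step may enter \<open>X\<close> only at \<open>v\<close>; then the rest of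
      the path is empty and \<open>w\<close> is the end, not an inner vertex.\<close>
    have "p = []" if "w = v"
      using p(2) that by (simp add: differ_def)
    then have "set (pre_digraph.inner_verts ?G ((u, w) # p)) \<inter> X = {}"
      using p(4) iX awalkI_apath[OF path] inner_verts_Cons[of u "(u, w)" p v]
      by (auto simp: w_def)
    moreover have "\<forall>z \<in> set (pre_digraph.awalk_verts ?G u ((u, w) # p)). differ z v \<subseteq> differ u v"
      using p(3) wv by auto
    moreover have "length ((u, w) # p) = card (differ u v)"
      using p(2) n Suc.hyps(2) by simp
    ultimately show ?case
      using path by blast
  qed
qed

lemma graph_dist_hamming_graph:
  assumes "u \<in> pverts (hamming_graph ns)" "v \<in> pverts (hamming_graph ns)"
  shows "graph_dist (hamming_graph ns) u v = ereal (real (card (differ u v)))"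
proof -
  interpret wf_digraph "with_proj (hamming_graph ns)" by (rule wf_digraph_hamming_graph)
  have cost: "awalk_cost (\<lambda>_. 1) p = real (length p)" for p :: "(nat list \<times> nat list) awalk"
    by (induction p) simp_all
  \<comment> \<open>For the empty set the condition on \<open>X\<close> is vacuous, and what remains
    is a path of the desired length.\<close>
  obtain p where p: "apath u p v" "length p = card (differ u v)"
    using ex_path_avoiding[OF assms, of "{}"] by auto
  show ?thesis
    unfolding graph_dist_def
  proof (rule antisym)
    show "\<mu> (\<lambda>_. 1) u v \<le> ereal (real (card (differ u v)))"
      using min_cost_le_walk_cost[OF awalkI_apath[OF p(1)], of "\<lambda>_. 1"] p(2) by (simp add: cost)
    show "ereal (real (card (differ u v))) \<le> \<mu> (\<lambda>_. 1) u v"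
      unfolding \<mu>_def
      by (rule INF_greatest) (simp add: cost card_differ_le_length_awalk)
  qed
qed

lemma graph_dist_hamming_graph_eq_2_iff:
  assumes "u \<in> pverts (hamming_graph ns)" "v \<in> pverts (hamming_graph ns)"
  shows "graph_dist (hamming_graph ns) u v = 2 \<longleftrightarrow> card (differ u v) = 2"
proof -
  \<comment> \<open>The numeral is an \<open>ereal\<close>; as the image of a natural number it can
    be compared with the cardinality by injectivity of the coercions.\<close>
  have "graph_dist (hamming_graph ns) u v = 2 \<longleftrightarrow>
      ereal (real (card (differ u v))) = ereal (real 2)"
    by (simp add: graph_dist_hamming_graph[OF assms])
  then show ?thesis by simp
qed

section \<open>Total mutual visibility and pairs at distance 2\<close>

lemma total_mutual_visibility_if_no_distance_2:
  assumes "X \<subseteq> pverts (hamming_graph ns)"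
    and "\<And>x y. x \<in> X \<Longrightarrow> y \<in> X \<Longrightarrow> card (differ x y) \<noteq> 2"
  shows "total_mutual_visibility_set (hamming_graph ns) X"
  unfolding total_mutual_visibility_set_def visible_def shortest_path_def
proof (intro conjI ballI)
  fix u v assume V: "u \<in> pverts (hamming_graph ns)" "v \<in> pverts (hamming_graph ns)"
  show "\<exists>p. (pre_digraph.apath (with_proj (hamming_graph ns)) u p v \<and>
       ereal (real (length p)) = graph_dist (hamming_graph ns) u v) \<and>
     set (pre_digraph.inner_verts (with_proj (hamming_graph ns)) p) \<inter> X = {}"
    using ex_path_avoiding[OF V, of X] assms(2) graph_dist_hamming_graph[OF V] by metis
qed fact

lemma no_distance_2_if_total_mutual_visibility:
  assumes X: "total_mutual_visibility_set (hamming_graph ns) X" and uv: "u \<in> X" "v \<in> X"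
  shows "card (differ u v) \<noteq> 2"
proof
  interpret wf_digraph "with_proj (hamming_graph ns)" by (rule wf_digraph_hamming_graph)
  assume "card (differ u v) = 2"
  then obtain i j where ij: "differ u v = {i, j}" "i \<noteq> j"
    by (auto simp: card_2_iff)
  have V: "u \<in> pverts (hamming_graph ns)" "v \<in> pverts (hamming_graph ns)"
    using X uv by (auto simp: total_mutual_visibility_set_def)
  \<comment> \<open>These form the other diagonal of the square. Visibility is applied to them,
    since the middle vertex of a shortest path between them is \<open>u\<close> or
    \<open>v\<close>.\<close>
  define w w' where "w = u[i := v ! i]" and "w' = u[j := v ! j]"
  have W: "w \<in> pverts (hamming_graph ns)" "w' \<in> pverts (hamming_graph ns)"
    using V by (simp_all add: w_def w'_def update_in_hamming_graph)
  have "card (differ w w') = 2"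
    using ij by (simp add: w_def w'_def differ_update_update)
  moreover obtain p where p: "apath w p w'"
    "ereal (real (length p)) = graph_dist (hamming_graph ns) w w'" "set (inner_verts p) \<inter> X = {}"
    using X W unfolding total_mutual_visibility_set_def visible_def shortest_path_def by blast
  ultimately have "length p = 2"
    by (simp add: graph_dist_hamming_graph[OF W])
  then obtain e f where "p = [e, f]"
    by (auto simp: numeral_2_eq_2 length_Suc_conv)
  with p(1) obtain z where pz: "p = [(w, z), (z, w')]"
    and arcs: "(w, z) \<in> parcs (hamming_graph ns)" "(z, w') \<in> parcs (hamming_graph ns)"
    by (cases e; cases f) (auto simp: apath_Cons_iff apath_Nil_iff)
  have "z = u \<or> z = v"
    using middle_of_path2[of u v z i j] arcs ij V
    by (auto simp: hamming_arc_iff w_def w'_def length_hamming_vertex)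
  moreover have "z \<notin> X"
    using p(3) pz by (simp add: inner_verts_def)
  ultimately show False
    using uv by blast
qed

section \<open>Cartesian squares and the equivalence\<close>

text \<open>The missing corners arise from \<open>u\<close> by copying one of the two differing
  coordinates from \<open>v\<close>.\<close>

lemma cartesian_square_diagonal:
  assumes V: "u \<in> pverts (hamming_graph ns)" "v \<in> pverts (hamming_graph ns)"
    and "card (differ u v) = 2"
  shows "\<exists>u' u'''. cartesian_square ns u u' v u'''"
proof -
  interpret wf_digraph "with_proj (hamming_graph ns)" by (rule wf_digraph_hamming_graph)
  obtain i j where ij: "differ u v = {i, j}" "i < j"
    using assms(3) by (metis card_2_iff insert_commute linorder_neqE_nat)
  have len: "length u = length ns" "length v = length ns"
    using V by (simp_all add: length_hamming_vertex)
  have "i \<in> differ u v" "j \<in> differ u v"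
    using ij by simp_all
  then have nth: "j < length ns" "v ! i \<noteq> u ! i" "v ! j \<noteq> u ! j"
    using len by (auto simp: differ_def)
  let ?w = "u[j := v ! j]" and ?z = "u[i := v ! i]"
  have W: "?w \<in> pverts (hamming_graph ns)" "?z \<in> pverts (hamming_graph ns)"
    using V by (simp_all add: update_in_hamming_graph)
  have "differ u ?w = {j}" "differ ?w v = {i}" "differ ?z u = {i}" "differ v ?z = {j}"
    using ij len differ_commute[of ?z u] differ_commute[of v ?z]
    by (auto simp: differ_update_left differ_update_right)
  then have arcs: "(u, ?w) \<in> parcs (hamming_graph ns)" "(?w, v) \<in> parcs (hamming_graph ns)"
    "(v, ?z) \<in> parcs (hamming_graph ns)" "(?z, u) \<in> parcs (hamming_graph ns)"
    using V W by (simp_all add: hamming_arc_iff)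
  have "differ ?z ?w = {i, j}"
    using ij by (intro differ_update_update) auto
  \<comment> \<open>A cycle has distinct vertices: the ends of each side are joined by an arc, and
    those of each diagonal differ in both \<open>i\<close> and \<open>j\<close>.\<close>
  then have "?w \<noteq> v" "?w \<noteq> ?z" "?w \<noteq> u" "v \<noteq> ?z" "v \<noteq> u" "?z \<noteq> u"
    using ij arcs by (auto simp: differ_def hamming_arc_iff)
  then have "cycle [(u, ?w), (?w, v), (v, ?z), (?z, u)]"
    using arcs V by (auto simp: cycle_def awalk_Cons_iff awalk_Nil_iff intro!: exI[of _ u])
  moreover have "v = u[i := v ! i, j := v ! j]"
    using ij len by (intro eq_update2_if_differ_eq) simp_all
  ultimately have "cartesian_square ns u ?w v ?z"
    unfolding cartesian_square_def
    by (intro conjI exI[of _ i] exI[of _ j] exI[of _ "v ! i"] exI[of _ "v ! j"] refl ij(2) nth)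
  then show ?thesis by blast
qed

theorem theorem2p3:
  fixes ns :: "nat list" and X :: "nat list set"
  assumes "length ns \<ge> 1"
    and "\<forall>n \<in> set ns. n \<ge> 2"
    and "X \<subseteq> pverts (hamming_graph ns)"
  shows "(total_mutual_visibility_set (hamming_graph ns) X \<longleftrightarrow>
            \<not> (\<exists>u \<in> X. \<exists>v \<in> X. graph_dist (hamming_graph ns) u v = 2)) \<and>
         (\<not> (\<exists>u \<in> X. \<exists>v \<in> X. graph_dist (hamming_graph ns) u v = 2) \<longleftrightarrow>
            (\<forall>u u' u'' u'''. cartesian_square ns u u' u'' u''' \<longrightarrow>
               suitable (hamming_graph ns) X {u, u', u'', u'''}))"
proof -
  let ?G = "hamming_graph ns"
  let ?far = "\<exists>u \<in> X. \<exists>v \<in> X. graph_dist ?G u v = 2"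
    and ?suit = "\<forall>u u' u'' u'''. cartesian_square ns u u' u'' u''' \<longrightarrow>
      suitable ?G X {u, u', u'', u'''}"
  have dist: "graph_dist ?G u v = 2 \<longleftrightarrow> card (differ u v) = 2" if "u \<in> X" "v \<in> X" for u v
    using assms(3) that by (intro graph_dist_hamming_graph_eq_2_iff) auto
  have "total_mutual_visibility_set ?G X \<longleftrightarrow> \<not> ?far"
  proof
    assume "total_mutual_visibility_set ?G X"
    then show "\<not> ?far"
      using dist no_distance_2_if_total_mutual_visibility by blast
  next
    assume "\<not> ?far"
    then show "total_mutual_visibility_set ?G X"
      using dist by (intro total_mutual_visibility_if_no_distance_2[OF assms(3)]) blast
  qed
  moreover have "\<not> ?far \<longleftrightarrow> ?suit"
  proof
    assume "\<not> ?far"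
    then show ?suit
      unfolding suitable_def by blast
  next
    assume suit: ?suit
    show "\<not> ?far"
    proof
      assume ?far
      then obtain u v where uv: "u \<in> X" "v \<in> X" "graph_dist ?G u v = 2"
        by blast
      have card: "card (differ u v) = 2"
        using dist[OF uv(1,2)] uv(3) by simp
      have "u \<in> pverts ?G" "v \<in> pverts ?G"
        using uv assms(3) by auto
      then obtain u' u''' where "cartesian_square ns u u' v u'''"
        using cartesian_square_diagonal[OF _ _ card] by blast
      then have "suitable ?G X {u, u', v, u'''}"
        using suit by blast
      \<comment> \<open>Adjacent vertices differ in one coordinate, these in two; hence the pair is
        diametral.\<close>
      moreover have "(u, v) \<notin> parcs ?G"
        using card by (auto simp: hamming_arc_iff)
      ultimately show False
        using uv unfolding suitable_def by blast
    qed
  qed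
  ultimately show ?thesis ..
qed

end
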